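(* Let $r,s\ge 1$ and $t\ge 2$ be integers. The expectation of the size $|\mathrm{core}_t(\lambda)|$ of the $t$-core of a uniformly random partition $\lambda\in\mathcal{P}_{r,s}$ equals $$\frac{rs}{(r+s)(r+s-1)}\left(\binom{(r+s)\bmod t}{2}+\left\lfloor\frac{r+s}{t}\right\rfloor\binom{t}{2}\right).$$
   Context: A partition $\lambda=(\lambda_1\ge\lambda_2\ge\cdots)$ is a weakly decreasing finite sequence of positive integers (possibly empty); $\ell(\lambda)$ is its number of parts and $|\lambda|=\sum_j\lambda_j$ its size. $\mathcal{P}_{r,s}$ is the (finite) set of partitions with $\ell(\lambda)\le r$ and $\lambda_1\le s$ (with $\lambda_1=0$ for the empty partition). A rim-hook of $\lambda$ is a connected skew shape $\lambda/\mu$ (with $\mu\subseteq\lambda$ a partition) containing no $2\times2$ block of boxes; a $t$-rim hook is one with exactly $t$ boxes. The $t$-core $\mathrm{core}_t(\lambda)$ is the partition obtained by successively removing $t$-rim hooks until none can be removed (it does not depend on the order of removals). Here $(r+s)\bmod t$ denotes the remainder in $\{0,1,\dots,t-1\}$, and $\binom{0}{2}=\binom{1}{2}=0$. *)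

theory Defs
  imports "HOL-Probability.Probability"
begin

definition int_partition :: "nat list \<Rightarrow> bool" where
  "int_partition lam \<longleftrightarrow> sorted_wrt (\<ge>) lam \<and> (\<forall>x \<in> set lam. x > 0)"

definition largest_part :: "nat list \<Rightarrow> nat" where
  "largest_part lam = (case lam of [] \<Rightarrow> 0 | x # _ \<Rightarrow> x)"

definition partitions_in_box :: "nat \<Rightarrow> nat \<Rightarrow> nat list set" where
  "partitions_in_box r s = {lam. int_partition lam \<and> length lam \<le> r \<and> largest_part lam \<le> s}"

(* Boxes are pairs (row, column), both counted from 0. *)
definition young_diagram :: "nat list \<Rightarrow> (nat \<times> nat) set" where
  "young_diagram lam = {(i, j). i < length lam \<and> j < lam ! i}"

definition adjacent_boxes :: "nat \<times> nat \<Rightarrow> nat \<times> nat \<Rightarrow> bool" where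
  "adjacent_boxes b c \<longleftrightarrow>
     (fst b = fst c \<and> (snd c = Suc (snd b) \<or> snd b = Suc (snd c))) \<or>
     (snd b = snd c \<and> (fst c = Suc (fst b) \<or> fst b = Suc (fst c)))"

definition connected_boxes :: "(nat \<times> nat) set \<Rightarrow> bool" where
  "connected_boxes S \<longleftrightarrow>
     (\<forall>b \<in> S. \<forall>c \<in> S. (\<lambda>x y. x \<in> S \<and> y \<in> S \<and> adjacent_boxes x y)\<^sup>*\<^sup>* b c)"

definition contains_2x2_block :: "(nat \<times> nat) set \<Rightarrow> bool" where
  "contains_2x2_block S \<longleftrightarrow>
     (\<exists>i j. {(i, j), (i, Suc j), (Suc i, j), (Suc i, Suc j)} \<subseteq> S)"

definition skew_shape :: "nat list \<Rightarrow> nat list \<Rightarrow> (nat \<times> nat) set" where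
  "skew_shape lam mu = young_diagram lam - young_diagram mu"

definition rim_hook :: "nat list \<Rightarrow> nat list \<Rightarrow> bool" where
  "rim_hook lam mu \<longleftrightarrow>
     int_partition lam \<and> int_partition mu \<and> young_diagram mu \<subseteq> young_diagram lam \<and>
     connected_boxes (skew_shape lam mu) \<and> \<not> contains_2x2_block (skew_shape lam mu)"

definition remove_rim_hook :: "nat \<Rightarrow> nat list \<Rightarrow> nat list \<Rightarrow> bool" where
  "remove_rim_hook t lam mu \<longleftrightarrow> rim_hook lam mu \<and> card (skew_shape lam mu) = t"

(* The definite description is meaningful because the end result does not depend
   on the order of removals (for t \<ge> 1). *)
definition t_core :: "nat \<Rightarrow> nat list \<Rightarrow> nat list" where
  "t_core t lam =
     (THE mu. (remove_rim_hook t)\<^sup>*\<^sup>* lam mu \<and> \<not> (\<exists>nu. remove_rim_hook t mu nu))"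

end

theory Submission imports Defs begin

text \<open>
  Encode a partition with at most \<open>r\<close> parts by its bead set
  \<open>{\<lambda>\<^sub>i + (r - 1 - i) | i < r}\<close>; partitions in the \<open>r \<times> s\<close> box
  correspond to the \<open>r\<close>-subsets of \<open>{0..<r + s}\<close>. Removing a \<open>t\<close>-rim hook moves one
  bead \<open>b\<close> to the unoccupied position \<open>b - t\<close>, so the core is reached when each residue class
  modulo \<open>t\<close> is pushed down, and its size depends only on the numbers \<open>n\<^sub>c\<close> of beads in the
  residue classes, through \<open>n\<^sub>c\<close> and \<open>n\<^sub>c choose 2\<close>. For a uniformly random \<open>r\<close>-subset the
  means of these are hypergeometric.
\<close>

section \<open>Row lengths and rim hooks\<close>

text \<open>Padding by zeros lets partitions of different lengths be compared row by row, and gives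
  a partition with fewer than \<open>r\<close> parts exactly \<open>r\<close> beads.\<close>

definition row_len :: "nat list \<Rightarrow> nat \<Rightarrow> nat" where
  "row_len lam i = (if i < length lam then lam ! i else 0)"

lemma row_len_antimono:
  assumes "int_partition lam" "i \<le> j"
  shows "row_len lam j \<le> row_len lam i"
  using assms sorted_wrt_nth_less[of "(\<ge>)" lam i j]
  by (cases "i = j") (auto simp: row_len_def int_partition_def)

lemma row_len_pos_iff:
  assumes "int_partition lam"
  shows "0 < row_len lam i \<longleftrightarrow> i < length lam"
  using assms by (auto simp: row_len_def int_partition_def)

lemma young_diagram_row_len: "young_diagram lam = {(i, j). j < row_len lam i}"
  by (auto simp: young_diagram_def row_len_def split: if_splits)

lemma largest_part_eq: "largest_part lam = row_len lam 0"
  by (cases lam) (auto simp: largest_part_def row_len_def)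

lemma sum_list_row_len:
  assumes "length lam \<le> r"
  shows "sum_list lam = (\<Sum>i<r. row_len lam i)"
proof -
  have "(\<Sum>i<r. row_len lam i) = (\<Sum>i<length lam. row_len lam i)"
    using assms by (intro sum.mono_neutral_right) (auto simp: row_len_def)
  also have "\<dots> = (\<Sum>i<length lam. lam ! i)"
    by (simp add: row_len_def)
  finally show ?thesis
    by (simp add: sum_list_sum_nth atLeast0LessThan)
qed

lemma row_len_inject:
  assumes "int_partition lam" "int_partition mu" "\<And>i. row_len lam i = row_len mu i"
  shows "lam = mu"
proof (rule nth_equalityI)
  show len: "length lam = length mu"
    using row_len_pos_iff[OF assms(1)] row_len_pos_iff[OF assms(2)] assms(3)
    by (metis linorder_neqE_nat less_irrefl)
  fix i assume "i < length lam"
  then show "lam ! i = mu ! i"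
    using assms(3)[of i] len by (simp add: row_len_def)
qed

text \<open>The parts are the values of \<open>f\<close> before its first zero;
  \<open>f r = 0\<close> places that zero at or before \<open>r\<close>. Later constructions thus
  only have to produce an antitone function.\<close>

lemma ex_partition_with_row_lens:
  assumes "antimono f" "f r = (0::nat)"
  obtains lam where "int_partition lam" "length lam \<le> r" "row_len lam = f"
proof -
  define n where "n = (LEAST i. f i = 0)"
  have n: "f n = 0" "n \<le> r"
    unfolding n_def using assms(2) by (auto intro: LeastI Least_le)
  have pos: "0 < f i" if "i < n" for i
    using not_less_Least[of i "\<lambda>i. f i = 0"] that by (auto simp: n_def)
  have zero: "f i = 0" if "n \<le> i" for i
    using antimonoD[OF assms(1) that] n by simp
  let ?lam = "map f [0..<n]"
  have "int_partition ?lam"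
    using pos antimonoD[OF assms(1)]
    by (auto simp: int_partition_def sorted_wrt_iff_nth_less)
  moreover have "row_len ?lam = f"
    using zero by (auto simp: row_len_def fun_eq_iff)
  ultimately show ?thesis
    using n that by auto
qed

text \<open>
  \<open>ribbon lam mu a e\<close>: the skew shape occupies exactly the rows \<open>a\<close> to \<open>e\<close>, and consecutive rows
  share exactly one column.
\<close>

definition ribbon :: "nat list \<Rightarrow> nat list \<Rightarrow> nat \<Rightarrow> nat \<Rightarrow> bool" where
  "ribbon lam mu a e \<longleftrightarrow>
     a \<le> e \<and> (\<forall>i. i < a \<or> e < i \<longrightarrow> row_len mu i = row_len lam i) \<and>
     (\<forall>i. a \<le> i \<and> i < e \<longrightarrow> row_len lam (Suc i) = Suc (row_len mu i)) \<and>
     row_len mu e < row_len lam e"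

lemma ribbon_less:
  assumes "int_partition lam" "ribbon lam mu a e" "a \<le> i" "i \<le> e"
  shows "row_len mu i < row_len lam i"
proof (cases "i = e")
  case False
  then have "row_len lam (Suc i) = Suc (row_len mu i)"
    using assms by (simp add: ribbon_def)
  then show ?thesis
    using row_len_antimono[OF assms(1), of i "Suc i"] by simp
qed (use assms in \<open>simp add: ribbon_def\<close>)

lemma ribbon_le:
  assumes "int_partition lam" "ribbon lam mu a e"
  shows "row_len mu i \<le> row_len lam i"
proof (cases "a \<le> i \<and> i \<le> e")
  case True
  then show ?thesis using ribbon_less[OF assms] by (simp add: less_imp_le)
qed (use assms in \<open>auto simp: ribbon_def\<close>)

lemma skew_shape_row_len: "skew_shape lam mu = {(i, j). row_len mu i \<le> j \<and> j < row_len lam i}"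
  by (auto simp: skew_shape_def young_diagram_row_len)

lemma card_skew_shape:
  assumes "length lam \<le> r"
  shows "card (skew_shape lam mu) = (\<Sum>i<r. row_len lam i - row_len mu i)"
proof -
  have "skew_shape lam mu = (SIGMA i:{..<r}. {row_len mu i..<row_len lam i})"
    using assms by (auto simp: skew_shape_row_len row_len_def split: if_splits)
  then show ?thesis by simp
qed

text \<open>The absence of a 2x2 block bounds the overlap of consecutive rows by one column, and
  connectedness forces at least one. The empty skew shape also satisfies \<open>rim_hook\<close>,
  but meets no row, hence the second assumption.\<close>

lemma rim_hook_ribbon:
  assumes "rim_hook lam mu" "skew_shape lam mu \<noteq> {}"
  obtains a e where "ribbon lam mu a e"
proof -
  let ?S = "skew_shape lam mu"
  have lam: "int_partition lam" and mu: "int_partition mu"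
    and sub: "young_diagram mu \<subseteq> young_diagram lam"
    and conn: "connected_boxes ?S" and no_block: "\<not> contains_2x2_block ?S"
    using assms(1) by (auto simp: rim_hook_def)
  have le: "row_len mu i \<le> row_len lam i" for i
  proof (rule ccontr)
    assume "\<not> ?thesis"
    then have "(i, row_len lam i) \<in> young_diagram mu - young_diagram lam"
      by (simp add: young_diagram_row_len)
    then show False using sub by blast
  qed
  define R where "R = {i. row_len mu i < row_len lam i}"
  obtain i j where "row_len mu i \<le> j" "j < row_len lam i"
    using assms(2) by (auto simp: skew_shape_row_len)
  then have "i \<in> R" by (simp add: R_def)
  then have "R \<noteq> {}" by blast
  have "R \<subseteq> {..<length lam}"
    by (auto simp: R_def row_len_def split: if_splits)
  then have fin: "finite R" by (rule finite_subset) simp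
  define a e where "a = Min R" and "e = Max R"
  have a: "a \<in> R" and e: "e \<in> R"
    using Min_in[OF fin \<open>R \<noteq> {}\<close>] Max_in[OF fin \<open>R \<noteq> {}\<close>] by (auto simp: a_def e_def)
  have "a \<le> e" using fin e by (simp add: a_def)
  have outside: "row_len mu i = row_len lam i" if "i < a \<or> e < i" for i
  proof -
    have "i \<notin> R" using that Min_le[OF fin, of i] Max_ge[OF fin, of i] by (auto simp: a_def e_def)
    then show ?thesis using le[of i] by (simp add: R_def)
  qed
  have inside: "row_len lam (Suc i) = Suc (row_len mu i)" if "a \<le> i" "i < e" for i
  proof (rule antisym)
    show "row_len lam (Suc i) \<le> Suc (row_len mu i)"
    proof (rule ccontr)
      assume "\<not> ?thesis"
      then have "{(i, row_len mu i), (i, Suc (row_len mu i)), (Suc i, row_len mu i), (Suc i, Suc (row_len mu i))} \<subseteq> ?S"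
        using row_len_antimono[OF lam, of i "Suc i"] row_len_antimono[OF mu, of i "Suc i"]
        by (simp add: skew_shape_row_len)
      then show False using no_block by (auto simp: contains_2x2_block_def)
    qed
    show "Suc (row_len mu i) \<le> row_len lam (Suc i)"
    proof (rule ccontr)
      assume gap: "\<not> ?thesis"
      \<comment> \<open>If rows \<open>i\<close> and \<open>Suc i\<close> share no column, a path
        that starts in row \<open>a\<close> can never get below row \<open>i\<close>, so it misses
        row \<open>e\<close>.\<close>
      let ?adj = "\<lambda>x y. x \<in> ?S \<and> y \<in> ?S \<and> adjacent_boxes x y"
      have "?adj\<^sup>*\<^sup>* (a, row_len mu a) (e, row_len mu e)"
        using conn a e unfolding connected_boxes_def
        by (simp add: skew_shape_row_len R_def)
      then have "fst (e, row_len mu e) \<le> i"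
      proof (induction rule: rtranclp_induct)
        case base
        then show ?case using that by simp
      next
        case (step y z)
        show ?case
        proof (rule ccontr)
          assume "\<not> fst z \<le> i"
          then have "fst y = i" "fst z = Suc i" "snd y = snd z"
            using step by (auto simp: adjacent_boxes_def)
          then show False using step(2) gap by (auto simp: skew_shape_row_len)
        qed
      qed
      then show False using that by simp
    qed
  qed
  show ?thesis
    using \<open>a \<le> e\<close> outside inside e by (intro that[of a e]) (auto simp: ribbon_def R_def)
qed

text \<open>Every box is joined to the last box of row \<open>a\<close>: go right to the end of the
  row, then up through the shared column, and repeat.\<close>

lemma ribbon_rim_hook:
  assumes lam: "int_partition lam" and mu: "int_partition mu" and rib: "ribbon lam mu a e"
  shows "rim_hook lam mu"
proof -
  let ?S = "skew_shape lam mu"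
  let ?adj = "\<lambda>x y. x \<in> ?S \<and> y \<in> ?S \<and> adjacent_boxes x y"
  note lt = ribbon_less[OF lam rib] and le = ribbon_le[OF lam rib]
  have rows: "a \<le> fst x \<and> fst x \<le> e" if "x \<in> ?S" for x
  proof (rule ccontr)
    assume "\<not> ?thesis"
    then have "row_len mu (fst x) = row_len lam (fst x)"
      using rib by (auto simp: ribbon_def)
    then show False using that by (auto simp: skew_shape_row_len)
  qed
  have overlap: "row_len lam (Suc i) = Suc (row_len mu i)" if "a \<le> i" "i < e" for i
    using rib that by (auto simp: ribbon_def)
  have in_row: "?adj\<^sup>*\<^sup>* (i, j) (i, row_len lam i - 1)" if "(i, j) \<in> ?S" for i j
  proof -
    have "j \<le> row_len lam i - 1" using that by (auto simp: skew_shape_row_len)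
    then show ?thesis using that
    proof (induction rule: inc_induct)
      case (step n)
      then have "?adj (i, n) (i, Suc n)"
        by (auto simp: skew_shape_row_len adjacent_boxes_def)
      moreover from this have "?adj\<^sup>*\<^sup>* (i, Suc n) (i, row_len lam i - 1)"
        using step by blast
      ultimately show ?case by (rule converse_rtranclp_into_rtranclp)
    qed simp
  qed
  have corner: "(i, row_len lam i - 1) \<in> ?S" if "a \<le> i" "i \<le> e" for i
    using lt[OF that] by (auto simp: skew_shape_row_len)
  have up: "?adj\<^sup>*\<^sup>* (i, row_len lam i - 1) (a, row_len lam a - 1)" if "a \<le> i" "i \<le> e" for i
    using that
  proof (induction rule: dec_induct)
    case (step i)
    \<comment> \<open>The last box of row \<open>Suc i\<close> lies directly below the first box of
      row \<open>i\<close>.\<close>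
    have "row_len lam (Suc i) - 1 = row_len mu i"
      using overlap[of i] step by simp
    moreover have "(i, row_len mu i) \<in> ?S"
      using lt[of i] step by (simp add: skew_shape_row_len)
    ultimately have "?adj (Suc i, row_len lam (Suc i) - 1) (i, row_len mu i)"
      using corner[of "Suc i"] step by (simp add: adjacent_boxes_def)
    moreover have "?adj\<^sup>*\<^sup>* (i, row_len mu i) (a, row_len lam a - 1)"
      using in_row[OF \<open>(i, row_len mu i) \<in> ?S\<close>] step by (meson Suc_leD rtranclp_trans)
    ultimately show ?case by (rule converse_rtranclp_into_rtranclp)
  qed simp
  have to_corner: "?adj\<^sup>*\<^sup>* x (a, row_len lam a - 1)" if "x \<in> ?S" for x
    using in_row[of "fst x" "snd x"] up[of "fst x"] rows[OF that] that
    by (metis (no_types, lifting) prod.collapse rtranclp_trans)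
  have "symp ?adj" by (auto simp: symp_def adjacent_boxes_def)
  then have sym: "?adj\<^sup>*\<^sup>* x y \<Longrightarrow> ?adj\<^sup>*\<^sup>* y x" for x y
    by (meson symp_rtranclp sympD)
  have "connected_boxes ?S"
    unfolding connected_boxes_def
    using to_corner sym by (meson rtranclp_trans)
  moreover have "\<not> contains_2x2_block ?S"
  proof
    assume "contains_2x2_block ?S"
    then obtain i j where ij: "(i, j) \<in> ?S" "(Suc i, Suc j) \<in> ?S"
      by (auto simp: contains_2x2_block_def)
    then have "row_len lam (Suc i) = Suc (row_len mu i)"
      using rows[OF ij(1)] rows[OF ij(2)] overlap[of i] by simp
    then show False using ij by (simp add: skew_shape_row_len)
  qed
  moreover have "young_diagram mu \<subseteq> young_diagram lam"
    using le by (auto simp: young_diagram_row_len intro: less_le_trans)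
  ultimately show ?thesis using lam mu by (simp add: rim_hook_def)
qed

section \<open>Bead sets\<close>

text \<open>These are the beta-numbers of \<open>lam\<close>, its first-column hook lengths when
  \<open>length lam = r\<close>. The added staircase turns weakly decreasing rows into strictly
  decreasing numbers.\<close>

definition bead :: "nat \<Rightarrow> nat list \<Rightarrow> nat \<Rightarrow> nat" where
  "bead r lam i = row_len lam i + (r - Suc i)"

definition beads :: "nat \<Rightarrow> nat list \<Rightarrow> nat set" where
  "beads r lam = bead r lam ` {..<r}"

lemma bead_strict_antimono:
  assumes "int_partition lam" "i < j" "j < r"
  shows "bead r lam j < bead r lam i"
  using row_len_antimono[OF assms(1), of i j] assms(2,3) by (simp add: bead_def)

lemma inj_on_bead:
  assumes "int_partition lam"
  shows "inj_on (bead r lam) {..<r}"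
  using bead_strict_antimono[OF assms]
  by (intro linorder_inj_onI) (metis lessThan_iff less_irrefl, rule linear)

lemma finite_beads [simp]: "finite (beads r lam)"
  by (simp add: beads_def)

lemma card_beads:
  assumes "int_partition lam"
  shows "card (beads r lam) = r"
  using inj_on_bead[OF assms] by (simp add: beads_def card_image)

text \<open>The staircase contributes 0 + 1 + ... + (r - 1), so sizes can be read off bead sums up
  to a constant.\<close>

lemma sum_beads:
  assumes "int_partition lam" "length lam \<le> r"
  shows "\<Sum>(beads r lam) = sum_list lam + (r choose 2)"
proof -
  have "(\<Sum>i<r. r - Suc i) = \<Sum>{..<r}"
    using sum.nat_diff_reindex[of "\<lambda>i. i" r] by simp
  then have "(\<Sum>i<r. r - Suc i) = r choose 2"
    by (simp add: gauss_sum_nat Sum_Ico_nat lessThan_atLeast0 choose_two)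
  then have "(\<Sum>i<r. bead r lam i) = sum_list lam + (r choose 2)"
    using sum_list_row_len[OF assms(2)] unfolding bead_def sum.distrib by simp
  then show ?thesis
    using inj_on_bead[OF assms(1)] by (simp add: beads_def sum.reindex)
qed

text \<open>A strictly monotone sequence is recovered from its set of values by sorting; removing
  the staircase then returns the rows.\<close>

lemma beads_inject:
  assumes "int_partition lam" "int_partition mu" "length lam \<le> r" "length mu \<le> r"
    and "beads r lam = beads r mu"
  shows "lam = mu"
proof (rule row_len_inject[OF assms(1,2)])
  have strict: "sorted_wrt (<) (map (bead r nu) (rev [0..<r]))" if "int_partition nu" for nu
    using bead_strict_antimono[OF that]
    by (auto simp: sorted_wrt_iff_nth_less rev_nth)
  have "map (bead r lam) (rev [0..<r]) = map (bead r mu) (rev [0..<r])"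
  proof (rule strict_sorted_equal)
    show "set (map (bead r lam) (rev [0..<r])) = set (map (bead r mu) (rev [0..<r]))"
      using assms(5) by (simp add: beads_def lessThan_atLeast0)
  qed (use strict assms in auto)
  then have *: "bead r lam i = bead r mu i" if "i < r" for i
    using that by simp
  show "row_len lam i = row_len mu i" for i
    using *[of i] assms(3,4) by (cases "i < r") (auto simp: bead_def row_len_def)
qed

text \<open>The encoding is inverted by sorting \<open>B\<close> and subtracting from each element
  its index.\<close>

lemma ex_beads:
  assumes "finite B" "card B = r"
  obtains lam where "int_partition lam" "length lam \<le> r" "beads r lam = B"
proof -
  define xs where "xs = sorted_list_of_set B"
  have xs: "set xs = B" "length xs = r" "sorted_wrt (<) xs"
    using assms by (auto simp: xs_def)
  have gap: "xs ! i + (j - i) \<le> xs ! j" if "i \<le> j" "j < r" for i j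
    using that
  proof (induction rule: dec_induct)
    case (step j)
    then have "xs ! j < xs ! Suc j"
      using xs by (simp add: sorted_wrt_nth_less)
    then show ?case using step by simp
  qed simp
  define f where "f i = (if i < r then xs ! (r - Suc i) - (r - Suc i) else 0)" for i
  have "antimono f"
  proof (rule antimonoI)
    fix i j :: nat assume "i \<le> j"
    show "f j \<le> f i"
    proof (cases "j < r")
      case True
      then have "xs ! (r - Suc j) + ((r - Suc i) - (r - Suc j)) \<le> xs ! (r - Suc i)"
        using gap[of "r - Suc j" "r - Suc i"] \<open>i \<le> j\<close> by simp
      moreover have "r - Suc j \<le> r - Suc i" using \<open>i \<le> j\<close> by simp
      ultimately have "xs ! (r - Suc j) - (r - Suc j) \<le> xs ! (r - Suc i) - (r - Suc i)"
        by linarith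
      then show ?thesis using True \<open>i \<le> j\<close> by (simp add: f_def)
    qed (simp add: f_def)
  qed
  moreover have "f r = 0" by (simp add: f_def)
  ultimately obtain lam where lam: "int_partition lam" "length lam \<le> r" "row_len lam = f"
    by (rule ex_partition_with_row_lens)
  \<comment> \<open>By \<open>gap\<close> from index 0, entry \<open>k\<close> of \<open>xs\<close>
    is at least \<open>k\<close>, so the subtraction in \<open>f\<close> is not truncated.\<close>
  have bead: "bead r lam i = xs ! (r - Suc i)" if "i < r" for i
    using gap[of 0 "r - Suc i"] that lam(3) by (simp add: bead_def f_def)
  have "beads r lam = (\<lambda>i. xs ! (r - Suc i)) ` {..<r}"
    unfolding beads_def using bead by (intro image_cong) auto
  also have "\<dots> = (!) xs ` ((\<lambda>i. r - Suc i) ` {..<r})"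
    by (simp add: image_image)
  also have "(\<lambda>i. r - Suc i) ` {..<r} = {..<r}"
  proof (intro equalityI subsetI)
    fix x assume "x \<in> {..<r}"
    then show "x \<in> (\<lambda>i. r - Suc i) ` {..<r}"
      by (intro image_eqI[of _ _ "r - Suc x"]) auto
  qed auto
  also have "(!) xs ` {..<r} = B"
    using xs by (auto simp: in_set_conv_nth)
  finally show ?thesis using lam that by blast
qed

lemma bij_betw_beads:
  "bij_betw (beads r) (partitions_in_box r s) {B. B \<subseteq> {..<r + s} \<and> card B = r}"
proof (rule bij_betwI')
  show "beads r lam = beads r mu \<longleftrightarrow> lam = mu"
    if "lam \<in> partitions_in_box r s" "mu \<in> partitions_in_box r s" for lam mu
    using that beads_inject by (auto simp: partitions_in_box_def)
  show "beads r lam \<in> {B. B \<subseteq> {..<r + s} \<and> card B = r}" if "lam \<in> partitions_in_box r s" for lam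
  proof -
    have lam: "int_partition lam" "row_len lam 0 \<le> s"
      using that by (auto simp: partitions_in_box_def largest_part_eq)
    have "bead r lam i < r + s" if "i < r" for i
      using row_len_antimono[OF lam(1), of 0 i] lam(2) that by (simp add: bead_def)
    then show ?thesis using card_beads[OF lam(1)] by (auto simp: beads_def)
  qed
  show "\<exists>lam\<in>partitions_in_box r s. B = beads r lam"
    if "B \<in> {B. B \<subseteq> {..<r + s} \<and> card B = r}" for B
  proof -
    have B: "B \<subseteq> {..<r + s}" "card B = r" using that by auto
    then obtain lam where lam: "int_partition lam" "length lam \<le> r" "beads r lam = B"
      using ex_beads finite_subset finite_lessThan by metis
    \<comment> \<open>The largest bead is \<open>row_len lam 0 + (r - 1)\<close>, so the bound
      \<open>r + s\<close> on beads is the bound \<open>s\<close> on the largest part. For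
      \<open>r = 0\<close> there is no bead, but \<open>lam\<close> is empty.\<close>
    have "row_len lam 0 \<le> s"
    proof (cases "r = 0")
      case False
      then have "bead r lam 0 \<in> B" using lam(3) by (auto simp: beads_def)
      then have "bead r lam 0 < r + s" using B by auto
      then show ?thesis using False by (simp add: bead_def)
    qed (use lam in \<open>simp add: row_len_def\<close>)
    then show ?thesis using lam by (auto simp: partitions_in_box_def largest_part_eq)
  qed
qed

section \<open>Rim hook removal as a move of one bead\<close>

text \<open>Inside the ribbon, row \<open>i\<close> of \<open>mu\<close> is one shorter than row
  \<open>Suc i\<close> of \<open>lam\<close>, which the staircase compensates: the two beads
  coincide. Only bead \<open>a\<close> of \<open>lam\<close> and bead \<open>e\<close> of
  \<open>mu\<close> remain unmatched.\<close>

lemma ribbon_beads: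
  assumes lam: "int_partition lam" and mu: "int_partition mu" and rib: "ribbon lam mu a e"
    and len: "length lam \<le> r"
  shows "a < r" "e < r"
    and "bead r mu e \<notin> beads r lam - {bead r lam a}"
    and "beads r mu = insert (bead r mu e) (beads r lam - {bead r lam a})"
    and "bead r lam a = bead r mu e + card (skew_shape lam mu)"
proof -
  have "a \<le> e" and "row_len mu e < row_len lam e" using rib by (auto simp: ribbon_def)
  then show er: "e < r" and ar: "a < r"
    using row_len_pos_iff[OF lam, of e] len by auto
  let ?X = "beads r lam - {bead r lam a}"
  have "bead r mu ` ({..<r} - {e}) = bead r lam ` ({..<r} - {a})"
  proof (intro equalityI image_subsetI)
    fix i assume i: "i \<in> {..<r} - {e}"
    show "bead r mu i \<in> bead r lam ` ({..<r} - {a})"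
    proof (cases "i < a \<or> e < i")
      case True
      then have "bead r mu i = bead r lam i" "i \<noteq> a"
        using rib by (auto simp: ribbon_def bead_def)
      then show ?thesis using i by auto
    next
      case False
      then have "bead r mu i = bead r lam (Suc i)"
        using i rib er by (auto simp: ribbon_def bead_def)
      then show ?thesis using False i er by (intro image_eqI) auto
    qed
  next
    fix i assume i: "i \<in> {..<r} - {a}"
    show "bead r lam i \<in> bead r mu ` ({..<r} - {e})"
    proof (cases "i < a \<or> e < i")
      case True
      then have "bead r lam i = bead r mu i" "i \<noteq> e"
        using rib by (auto simp: ribbon_def bead_def)
      then show ?thesis using i by auto
    next
      case False
      then obtain k where k: "i = Suc k" "a \<le> k" "k < e"
        using i by (cases i) auto
      then have "bead r lam i = bead r mu k"
        using i rib er by (auto simp: ribbon_def bead_def)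
      then show ?thesis using k er by (intro image_eqI) auto
    qed
  qed
  moreover have "bead r lam ` ({..<r} - {a}) = ?X"
    using inj_on_image_set_diff[OF inj_on_bead[OF lam, of r], of "{..<r}" "{a}"] ar
    by (simp add: beads_def)
  moreover have "bead r mu ` ({..<r} - {e}) = beads r mu - {bead r mu e}"
    using inj_on_image_set_diff[OF inj_on_bead[OF mu, of r], of "{..<r}" "{e}"] er
    by (simp add: beads_def)
  ultimately have eq: "beads r mu - {bead r mu e} = ?X" by simp
  have mem: "bead r lam a \<in> beads r lam" "bead r mu e \<in> beads r mu"
    using ar er by (auto simp: beads_def)
  show "bead r mu e \<notin> ?X" using eq by blast
  show "beads r mu = insert (bead r mu e) ?X" using eq mem by blast
  \<comment> \<open>The length of the jump comes from comparing total bead sums, since all other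
    beads cancel.\<close>
  have "(\<Sum>i<r. bead r lam i) = (\<Sum>i<r. bead r mu i) + card (skew_shape lam mu)"
    unfolding card_skew_shape[OF len] sum.distrib[symmetric]
    using ribbon_le[OF lam rib] by (intro sum.cong) (auto simp: bead_def)
  then have "\<Sum>(beads r lam) = \<Sum>(beads r mu) + card (skew_shape lam mu)"
    using inj_on_bead[OF lam] inj_on_bead[OF mu] by (simp add: beads_def sum.reindex)
  moreover have "\<Sum>(beads r lam) = bead r lam a + \<Sum>?X" "\<Sum>(beads r mu) = bead r mu e + \<Sum>?X"
    using sum.remove[OF _ mem(1)] sum.remove[OF _ mem(2)] eq by simp_all
  ultimately show "bead r lam a = bead r mu e + card (skew_shape lam mu)" by simp
qed

text \<open>The converse: the bead \<open>b\<close> of row \<open>a\<close> jumps over the beads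
  strictly between \<open>b - t\<close> and \<open>b\<close>; the rows of these beads move up by one
  and shrink by one box.\<close>

lemma ex_ribbon:
  assumes lam: "int_partition lam" and len: "length lam \<le> r" and "t > 0"
    and b: "b \<in> beads r lam" "t \<le> b" "b - t \<notin> beads r lam"
  obtains mu a e where "int_partition mu" "ribbon lam mu a e" "bead r lam a = b" "bead r mu e = b - t"
proof -
  obtain a where a: "a < r" "bead r lam a = b"
    using b(1) by (auto simp: beads_def)
  \<comment> \<open>The last row \<open>e\<close> in \<open>E\<close> is where the moved bead lands:
    all later beads lie below \<open>b - t\<close>.\<close>
  define E where "E = {i. i < r \<and> b - t < bead r lam i}"
  define e where "e = Max E"
  have fin: "finite E" by (simp add: E_def)
  have "a \<in> E" using a b(2) \<open>t > 0\<close> by (simp add: E_def)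
  then have "e \<in> E" "a \<le> e"
    using Max_in[OF fin] Max_ge[OF fin] unfolding e_def by blast+
  then have e: "e < r" "b - t < bead r lam e" by (auto simp: E_def)
  have above: "bead r lam i < b - t" if "e < i" "i < r" for i
  proof -
    have "i \<notin> E" using that Max_ge[OF fin, of i] by (auto simp: e_def)
    moreover have "bead r lam i \<noteq> b - t" using b(3) that unfolding beads_def by (metis image_eqI lessThan_iff)
    ultimately show ?thesis using that by (simp add: E_def)
  qed
  \<comment> \<open>This makes the subtraction defining \<open>f e\<close> exact and gives
    \<open>f (Suc e) \<le> f e\<close>. If \<open>e\<close> is the last of the \<open>r\<close>
    rows, row \<open>Suc e\<close> has length 0.\<close>
  have low: "r - Suc e + row_len lam (Suc e) \<le> b - t"
  proof (cases "Suc e < r")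
    case True
    then show ?thesis using above[of "Suc e"] by (simp add: bead_def)
  next
    case False
    then show ?thesis using len e by (simp add: row_len_def)
  qed
  \<comment> \<open>Rows up to \<open>e\<close> are then nonempty, so the predecessors in
    \<open>f\<close> are not truncated.\<close>
  have pos: "0 < row_len lam e" using e low by (simp add: bead_def)
  define f where "f i = (if i < a \<or> e < i then row_len lam i
      else if i < e then row_len lam (Suc i) - 1 else b - t - (r - Suc e))" for i
  note anti = row_len_antimono[OF lam]
  have "f (Suc i) \<le> f i" for i
  proof -
    consider "Suc i < a" | "Suc i = a" | "a \<le> i" "Suc i < e" | "a \<le> i" "Suc i = e" | "i = e" | "e < i"
      by linarith
    then show ?thesis
    proof cases
      case 2
      then show ?thesis
        using anti[of i "Suc a"] anti[of i e] e \<open>a \<le> e\<close> anti[of i a] a b(2)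
        by (auto simp: f_def bead_def)
    next
      case 3
      then show ?thesis using anti[of "Suc i" "Suc (Suc i)"] by (auto simp: f_def)
    next
      case 4
      then show ?thesis using e by (auto simp: f_def bead_def)
    qed (use anti[of i "Suc i"] \<open>a \<le> e\<close> low in \<open>auto simp: f_def\<close>)
  qed
  then have "antimono f" by (simp add: antimono_iff_le_Suc)
  moreover have "f r = 0" using len e(1) by (simp add: f_def row_len_def)
  ultimately obtain mu where mu: "int_partition mu" "row_len mu = f"
    by (rule ex_partition_with_row_lens)
  have "row_len lam (Suc i) = Suc (f i)" if "a \<le> i" "i < e" for i
    using that pos anti[of "Suc i" e] by (simp add: f_def)
  then have "ribbon lam mu a e"
    using \<open>a \<le> e\<close> e mu(2) low by (auto simp: ribbon_def f_def bead_def)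
  moreover have "bead r mu e = b - t"
    using low \<open>a \<le> e\<close> mu(2) by (simp add: bead_def f_def)
  ultimately show ?thesis using that mu(1) a(2) by blast
qed

lemma remove_rim_hook_beads:
  assumes "remove_rim_hook t lam mu" "t > 0" "length lam \<le> r"
  obtains b where "b \<in> beads r lam" "t \<le> b" "b - t \<notin> beads r lam"
    "beads r mu = insert (b - t) (beads r lam - {b})" "int_partition mu" "length mu \<le> r"
proof -
  have hook: "rim_hook lam mu" and card: "card (skew_shape lam mu) = t"
    using assms(1) by (auto simp: remove_rim_hook_def)
  then have lam: "int_partition lam" and mu: "int_partition mu" by (auto simp: rim_hook_def)
  \<comment> \<open>Here \<open>t > 0\<close> excludes the empty skew shape.\<close>
  have "skew_shape lam mu \<noteq> {}" using card assms(2) by auto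
  then obtain a e where rib: "ribbon lam mu a e"
    using rim_hook_ribbon[OF hook] by blast
  note bds = ribbon_beads[OF lam mu rib assms(3)]
  have "row_len mu r = 0"
    using ribbon_le[OF lam rib, of r] assms(3) by (simp add: row_len_def)
  then have "length mu \<le> r" using row_len_pos_iff[OF mu, of r] by simp
  moreover have eq: "bead r lam a - t = bead r mu e" and "t \<le> bead r lam a"
    using bds(5) card by simp_all
  moreover have "bead r lam a \<in> beads r lam" using bds(1) by (simp add: beads_def)
  moreover have "bead r lam a - t \<notin> beads r lam"
    using bds(3,5) card assms(2) unfolding eq by simp
  ultimately show ?thesis
    using bds(4) mu by (intro that[of "bead r lam a"]) simp_all
qed

lemma ex_remove_rim_hook:
  assumes "int_partition lam" "length lam \<le> r" "t > 0"
    and "b \<in> beads r lam" "t \<le> b" "b - t \<notin> beads r lam"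
  shows "\<exists>mu. remove_rim_hook t lam mu"
proof -
  obtain mu a e where mu: "int_partition mu" "ribbon lam mu a e" "bead r lam a = b" "bead r mu e = b - t"
    using ex_ribbon[OF assms] .
  have "card (skew_shape lam mu) = t"
    using ribbon_beads(5)[OF assms(1) mu(1,2) assms(2)] mu(3,4) assms(5) by simp
  then show ?thesis
    using ribbon_rim_hook[OF assms(1) mu(1,2)] by (auto simp: remove_rim_hook_def)
qed

section \<open>Residue classes and cores\<close>

definition residue_count :: "nat \<Rightarrow> nat set \<Rightarrow> nat \<Rightarrow> nat" where
  "residue_count t B c = card {b \<in> B. b mod t = c}"

text \<open>A move by \<open>t\<close> stays in its residue class, so these counts are the invariant
  of rim hook removal.\<close>

lemma residue_count_move:
  assumes "finite B" "b \<in> B" "t \<le> b" "b - t \<notin> B"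
  shows "residue_count t (insert (b - t) (B - {b})) c = residue_count t B c"
proof -
  have mod: "(b - t) mod t = b mod t" using assms(3) by (simp add: le_mod_geq)
  show ?thesis
  proof (cases "b mod t = c")
    case True
    have "{x \<in> insert (b - t) (B - {b}). x mod t = c} = insert (b - t) ({x \<in> B. x mod t = c} - {b})"
      using True mod by auto
    moreover have "card {x \<in> B. x mod t = c} = Suc (card ({x \<in> B. x mod t = c} - {b}))"
      using True assms by (intro card.remove) auto
    ultimately show ?thesis using assms by (simp add: residue_count_def)
  next
    case False
    then have "{x \<in> insert (b - t) (B - {b}). x mod t = c} = {x \<in> B. x mod t = c}"
      using mod by auto
    then show ?thesis by (simp add: residue_count_def)
  qed
qed

text \<open>On the abacus with \<open>t\<close> runners: no bead has a free position directly below
  it.\<close>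

definition flush :: "nat \<Rightarrow> nat set \<Rightarrow> bool" where
  "flush t B \<longleftrightarrow> (\<forall>b\<in>B. t \<le> b \<longrightarrow> b - t \<in> B)"

lemma downward_closed_eq_lessThan:
  fixes K :: "nat set"
  assumes "finite K" "\<And>k. Suc k \<in> K \<Longrightarrow> k \<in> K"
  shows "K = {..<card K}"
proof -
  have down: "i \<in> K" if "i \<le> k" "k \<in> K" for i k
    using that by (induction rule: inc_induct) (auto intro: assms(2))
  show ?thesis
  proof (cases "K = {}")
    case False
    have "K = {..Max K}"
      using down[OF _ Max_in[OF assms(1) False]] Max_ge[OF assms(1)] by auto
    then have "card K = Suc (Max K)" by (metis card_atMost)
    then show ?thesis using \<open>K = {..Max K}\<close> by (simp add: lessThan_Suc_atMost)
  qed simp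
qed

text \<open>Division by \<open>t\<close> turns flushness of a class into downward closure of its set
  \<open>K\<close> of quotients, and a finite downward closed set of naturals is an initial
  segment.\<close>

lemma flush_class:
  assumes "finite B" "flush t B" "c < t"
  shows "{b \<in> B. b mod t = c} = (\<lambda>k. c + k * t) ` {..<residue_count t B c}"
proof -
  let ?f = "\<lambda>k. c + k * t"
  define K where "K = {k. ?f k \<in> B}"
  have inj: "inj ?f" using assms(3) by (auto intro: injI)
  have cls: "{b \<in> B. b mod t = c} = ?f ` K"
  proof (intro equalityI subsetI)
    fix b assume "b \<in> {b \<in> B. b mod t = c}"
    then have "b \<in> B" "b = ?f (b div t)" using assms(3) by auto
    then show "b \<in> ?f ` K" by (auto simp: K_def)
  qed (use assms(3) in \<open>auto simp: K_def\<close>)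
  have "finite (?f ` K)" using assms(1) by (auto simp flip: cls)
  then have "finite K" using inj by (metis finite_imageD inj_on_subset subset_UNIV)
  moreover have "k \<in> K" if "Suc k \<in> K" for k
  proof -
    have "?f (Suc k) - t \<in> B" using that assms(2) by (auto simp: K_def flush_def)
    then show ?thesis by (simp add: K_def)
  qed
  ultimately have "K = {..<card K}" by (rule downward_closed_eq_lessThan)
  moreover have "card K = residue_count t B c"
    unfolding residue_count_def cls using inj by (simp add: card_image inj_on_subset)
  ultimately show ?thesis unfolding cls by simp
qed

lemma residue_classes: "t > 0 \<Longrightarrow> B = (\<Union>c<t. {b \<in> B. b mod t = (c::nat)})"
  by auto

lemma flush_unique:
  assumes "finite A" "finite B" "flush t A" "flush t B" "t > 0"
    and "\<And>c. residue_count t A c = residue_count t B c"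
  shows "A = B"
proof -
  have "{b \<in> A. b mod t = c} = {b \<in> B. b mod t = c}" if "c < t" for c
    using flush_class[OF assms(1,3) that] flush_class[OF assms(2,4) that] assms(6) by simp
  then show ?thesis
    using residue_classes[OF assms(5), of A] residue_classes[OF assms(5), of B] by simp
qed

lemma sum_arith_progression:
  "(\<Sum>k<n. c + k * t) = c * n + t * (n choose 2)" for c t n :: nat
  by (induction n) (auto simp: algebra_simps numeral_2_eq_2)

lemma sum_residue_classes:
  fixes g :: "nat \<Rightarrow> nat"
  assumes "finite B" "t > 0"
  shows "sum g B = (\<Sum>c<t. sum g {b \<in> B. b mod t = c})"
  using sum.group[of B "{..<t}" "\<lambda>b. b mod t" g] assms by (simp add: image_subset_iff)

lemma sum_flush:
  assumes "finite B" "flush t B" "t > 0"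
  shows "\<Sum>B = (\<Sum>c<t. c * residue_count t B c + t * (residue_count t B c choose 2))"
proof -
  have "\<Sum>{b \<in> B. b mod t = c} = c * residue_count t B c + t * (residue_count t B c choose 2)"
    if "c < t" for c
  proof -
    have "inj_on (\<lambda>k. c + k * t) {..<residue_count t B c}"
      using assms(3) by (auto intro: inj_onI)
    then show ?thesis
      using flush_class[OF assms(1,2) that] by (simp add: sum.reindex sum_arith_progression)
  qed
  then show ?thesis using sum_residue_classes[OF assms(1,3), of "\<lambda>b. b"] by simp
qed

section \<open>Existence, uniqueness and size of the core\<close>

lemma remove_rim_hooks_residue_count:
  assumes "(remove_rim_hook t)\<^sup>*\<^sup>* lam mu" "t > 0" "int_partition lam" "length lam \<le> r"
  shows "int_partition mu \<and> length mu \<le> r \<and>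
         (\<forall>c. residue_count t (beads r mu) c = residue_count t (beads r lam) c)"
  using assms(1)
proof (induction rule: rtranclp_induct)
  case (step mu nu)
  then have "length mu \<le> r" by simp
  then obtain b where b: "b \<in> beads r mu" "t \<le> b" "b - t \<notin> beads r mu"
    "beads r nu = insert (b - t) (beads r mu - {b})" "int_partition nu" "length nu \<le> r"
    using remove_rim_hook_beads[OF step(2) assms(2)] by blast
  then show ?case
    using residue_count_move[OF _ b(1-3)] step.IH by simp
qed (use assms in simp)

lemma flush_terminal:
  assumes "int_partition mu" "length mu \<le> r" "t > 0" "\<not> (\<exists>nu. remove_rim_hook t mu nu)"
  shows "flush t (beads r mu)"
  using ex_remove_rim_hook[OF assms(1-3)] assms(4) by (auto simp: flush_def)

text \<open>For \<open>t > 0\<close> each removal strictly decreases the number of boxes.\<close>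

lemma ex_terminal:
  assumes "t > 0"
  shows "\<exists>mu. (remove_rim_hook t)\<^sup>*\<^sup>* lam mu \<and> \<not> (\<exists>nu. remove_rim_hook t mu nu)"
proof (induction "card (young_diagram lam)" arbitrary: lam rule: less_induct)
  case less
  show ?case
  proof (cases "\<exists>nu. remove_rim_hook t lam nu")
    case True
    then obtain nu where nu: "remove_rim_hook t lam nu" ..
    then have "young_diagram nu \<subset> young_diagram lam"
      using assms by (auto simp: remove_rim_hook_def rim_hook_def skew_shape_def)
    moreover have "young_diagram lam = (SIGMA i:{..<length lam}. {..<lam ! i})"
      by (auto simp: young_diagram_def)
    then have "finite (young_diagram lam)" by simp
    ultimately have "card (young_diagram nu) < card (young_diagram lam)"
      by (intro psubset_card_mono)
    from less[OF this] nu show ?thesis by (meson converse_rtranclp_into_rtranclp)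
  qed blast
qed

text \<open>Justifies the definite description: two terminal partitions reachable from
  \<open>lam\<close> have flush bead sets with the same residue counts, and these determine the
  set.\<close>

lemma t_core_props:
  assumes "t > 0" "int_partition lam"
  shows "(remove_rim_hook t)\<^sup>*\<^sup>* lam (t_core t lam) \<and> \<not> (\<exists>nu. remove_rim_hook t (t_core t lam) nu)"
  unfolding t_core_def
proof (rule theI')
  let ?P = "\<lambda>mu. (remove_rim_hook t)\<^sup>*\<^sup>* lam mu \<and> \<not> (\<exists>nu. remove_rim_hook t mu nu)"
  have "mu = nu" if "?P mu" "?P nu" for mu nu
  proof -
    let ?r = "length lam"
    have mu: "int_partition mu" "length mu \<le> ?r"
      "\<And>c. residue_count t (beads ?r mu) c = residue_count t (beads ?r lam) c"
      and nu: "int_partition nu" "length nu \<le> ?r"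
      "\<And>c. residue_count t (beads ?r nu) c = residue_count t (beads ?r lam) c"
      using remove_rim_hooks_residue_count[OF _ assms, of _ ?r] that by blast+
    have "flush t (beads ?r mu)" "flush t (beads ?r nu)"
      using flush_terminal[OF mu(1,2) assms(1)] flush_terminal[OF nu(1,2) assms(1)] that by blast+
    then have "beads ?r mu = beads ?r nu"
      using mu(3) nu(3) assms(1) by (intro flush_unique) auto
    then show ?thesis using beads_inject mu nu by blast
  qed
  then show "\<exists>!mu. ?P mu" using ex_terminal[OF assms(1), of lam] by blast
qed

text \<open>Passes from the core to the residue counts of \<open>lam\<close> itself, so that the
  average needs no further reference to removals.\<close>

lemma sum_list_t_core:
  assumes "t > 0" "int_partition lam" "length lam \<le> r"
  shows "sum_list (t_core t lam) + (r choose 2) =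
    (\<Sum>c<t. c * residue_count t (beads r lam) c + t * (residue_count t (beads r lam) c choose 2))"
proof -
  note core = t_core_props[OF assms(1,2)]
  then have *: "int_partition (t_core t lam)" "length (t_core t lam) \<le> r"
    "\<And>c. residue_count t (beads r (t_core t lam)) c = residue_count t (beads r lam) c"
    using remove_rim_hooks_residue_count[OF _ assms] by blast+
  then have "flush t (beads r (t_core t lam))"
    using flush_terminal assms(1) core by blast
  then show ?thesis
    using sum_flush[OF finite_beads _ assms(1)] sum_beads[OF *(1,2)] *(3) by simp
qed

section \<open>Averages over subsets\<close>

text \<open>Factorial moments of the hypergeometric distribution, multiplied out to stay in the
  naturals. Pairs of a set \<open>B\<close> and a \<open>j\<close>-subset \<open>P\<close> of its
  intersection with \<open>M\<close> are counted by \<open>P\<close> first: each \<open>P\<close>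
  extends to \<open>B\<close> in \<open>(card A - j) choose (r - j)\<close> ways.\<close>

lemma sum_choose_inter:
  assumes "finite A" "M \<subseteq> A"
  shows "(card A choose j) * (\<Sum>B | B \<subseteq> A \<and> card B = r. card (B \<inter> M) choose j) =
    (card M choose j) * (r choose j) * (card A choose r)"
proof (cases "j \<le> r \<and> r \<le> card A")
  case True
  let ?subs = "\<lambda>X k. {P. P \<subseteq> X \<and> card P = k}"
  have fin: "finite (?subs A r)" "finite M" "finite (?subs M j)"
    using assms finite_subset[OF assms(2)] by simp_all
  have "(\<Sum>B\<in>?subs A r. card (B \<inter> M) choose j) = (\<Sum>B\<in>?subs A r. card {P \<in> ?subs M j. P \<subseteq> B})"
  proof (rule sum.cong)
    fix B
    have "card (B \<inter> M) choose j = card (?subs (B \<inter> M) j)"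
      using fin by (intro n_subsets[symmetric]) simp
    also have "?subs (B \<inter> M) j = {P \<in> ?subs M j. P \<subseteq> B}" by auto
    finally show "card (B \<inter> M) choose j = card {P \<in> ?subs M j. P \<subseteq> B}" .
  qed simp
  also have "\<dots> = (\<Sum>P\<in>?subs M j. card {B \<in> ?subs A r. P \<subseteq> B})"
    using sum.swap_restrict[OF fin(1) fin(3), of "\<lambda>_ _. 1::nat" "\<lambda>B P. P \<subseteq> B"] by simp
  also have "\<dots> = (\<Sum>P\<in>?subs M j. (card A - j) choose (r - j))"
  proof (rule sum.cong)
    fix P assume "P \<in> ?subs M j"
    then have P: "P \<subseteq> A" "card P = j" "finite P"
      using assms(2) finite_subset[OF _ fin(2)] by auto
    have "bij_betw (\<lambda>B. B - P) {B \<in> ?subs A r. P \<subseteq> B} (?subs (A - P) (r - j))"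
    proof (rule bij_betwI[where g = "\<lambda>C. C \<union> P"])
      show "(\<lambda>C. C \<union> P) \<in> ?subs (A - P) (r - j) \<rightarrow> {B \<in> ?subs A r. P \<subseteq> B}"
      proof
        fix C assume C: "C \<in> ?subs (A - P) (r - j)"
        then have "finite C" "C \<inter> P = {}" using assms(1) finite_subset by auto
        then show "C \<union> P \<in> {B \<in> ?subs A r. P \<subseteq> B}"
          using C P True by (auto simp: card_Un_disjoint)
      qed
    qed (use P in \<open>auto simp: card_Diff_subset\<close>)
    then have "card {B \<in> ?subs A r. P \<subseteq> B} = card (?subs (A - P) (r - j))"
      by (rule bij_betw_same_card)
    then show "card {B \<in> ?subs A r. P \<subseteq> B} = (card A - j) choose (r - j)"
      using n_subsets[of "A - P" "r - j"] assms(1) P by (simp add: card_Diff_subset)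
  qed simp
  also have "\<dots> = (card M choose j) * ((card A - j) choose (r - j))"
    using n_subsets[OF fin(2)] by simp
  finally have "(\<Sum>B\<in>?subs A r. card (B \<inter> M) choose j) = (card M choose j) * ((card A - j) choose (r - j))" .
  moreover have "(card A choose j) * ((card A - j) choose (r - j)) = (card A choose r) * (r choose j)"
    using choose_mult[of j r "card A"] True by simp
  ultimately show ?thesis by (simp add: ac_simps)
next
  case False
  \<comment> \<open>If \<open>r < j\<close> every summand vanishes; if \<open>card A < r\<close>
    there is no \<open>B\<close> at all.\<close>
  have "(\<Sum>B | B \<subseteq> A \<and> card B = r. card (B \<inter> M) choose j) = 0"
  proof (rule sum.neutral, safe)
    fix B assume B: "B \<subseteq> A" "r = card B"
    then have "card B \<le> card A" "finite B" using assms(1) by (auto intro: card_mono finite_subset)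
    moreover from this have "card (B \<inter> M) \<le> card B" by (intro card_mono) auto
    ultimately show "card (B \<inter> M) choose j = 0" using False B by simp
  qed
  then show ?thesis using False by (auto simp: not_le)
qed

lemma sum_mod_lessThan:
  assumes "t > (0::nat)"
  shows "(\<Sum>x<N. x mod t) = (N mod t choose 2) + (N div t) * (t choose 2)"
proof -
  \<comment> \<open>The bound is \<open>k \<le> t\<close>, not \<open>k < t\<close>: the instance
    \<open>k = t\<close> for \<open>q\<close> is the instance \<open>k = 0\<close> for
    \<open>Suc q\<close>.\<close>
  have rem: "(\<Sum>x<q * t + k. x mod t) = (k choose 2) + q * (t choose 2)" if "k \<le> t" for q k
    using that
  proof (induction q arbitrary: k)
    case 0
    have "(\<Sum>x<k. x mod t) = (\<Sum>x<k. 0 + x * 1)" using 0 by (intro sum.cong) auto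
    then show ?case unfolding sum_arith_progression by simp
  next
    case (Suc q)
    note IH = Suc.IH[of t]
    show ?case using Suc.prems
    proof (induction k)
      case 0
      then show ?case using IH by (simp add: algebra_simps)
    next
      case (Suc k)
      have "(Suc q * t + k) mod t = k"
        using Suc.prems mod_mult_self3[of "Suc q" t k] by simp
      then show ?case using Suc by (simp add: numeral_2_eq_2)
    qed
  qed
  show ?thesis using rem[of "N mod t" "N div t"] assms by (simp add: less_imp_le)
qed

section \<open>The expected size of the core\<close>

theorem proposition4p4:
  fixes r s t :: nat
  assumes "r \<ge> 1" and "s \<ge> 1" and "t \<ge> 2"
  shows "measure_pmf.expectation (pmf_of_set (partitions_in_box r s))
           (\<lambda>lam. real (sum_list (t_core t lam))) =
         real (r * s) / (real (r + s) * (real (r + s) - 1)) *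
           (real (((r + s) mod t) choose 2) + real ((r + s) div t) * real (t choose 2))"
proof -
  define N where "N = r + s"
  define Sub where "Sub = {B. B \<subseteq> {..<N} \<and> card B = r}"
  define M where "M c = {x \<in> {..<N}. x mod t = c}" for c
  have t: "t > 0" using assms by simp
  have bij: "bij_betw (beads r) (partitions_in_box r s) Sub"
    using bij_betw_beads by (simp add: Sub_def N_def)
  have "finite Sub" by (simp add: Sub_def)
  then have fin: "finite (partitions_in_box r s)"
    using bij bij_betw_finite by blast
  have card_Sub: "card Sub = N choose r"
    using n_subsets[of "{..<N}" r] by (simp add: Sub_def)
  then have card: "card (partitions_in_box r s) = N choose r"
    using bij_betw_same_card[OF bij] by simp
  have pos: "N choose r > 0" by (simp add: N_def)
  then have nonempty: "partitions_in_box r s \<noteq> {}" using card by auto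

  have sums: "(N choose j) * (\<Sum>B\<in>Sub. residue_count t B c choose j) =
      (card (M c) choose j) * (r choose j) * (N choose r)" for c j
  proof -
    have "residue_count t B c = card (B \<inter> M c)" if "B \<in> Sub" for B
    proof -
      have "{b \<in> B. b mod t = c} = B \<inter> M c" using that by (auto simp: Sub_def M_def)
      then show ?thesis by (simp add: residue_count_def)
    qed
    then have "(\<Sum>B\<in>Sub. residue_count t B c choose j) = (\<Sum>B\<in>Sub. card (B \<inter> M c) choose j)"
      by simp
    moreover have "M c \<subseteq> {..<N}" by (auto simp: M_def)
    ultimately show ?thesis
      using sum_choose_inter[of "{..<N}" "M c" j r] by (simp add: Sub_def)
  qed
  \<comment> \<open>\<open>W\<close> and \<open>V\<close> are the two parts of the flush sum formula
    for the full set \<open>{..<N}\<close>. That set is itself flush, so \<open>W + V\<close> is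
    known and \<open>V\<close> can be eliminated.\<close>
  define W V where "W = (\<Sum>c<t. c * card (M c))" and "V = (\<Sum>c<t. t * (card (M c) choose 2))"
  have "flush t {..<N}" by (auto simp: flush_def)
  then have "W + V = \<Sum>{..<N}"
    using sum_flush[of "{..<N}" t] t by (simp add: W_def V_def M_def residue_count_def sum.distrib)
  then have WV: "real W + real V = real (N choose 2)"
    using sum_arith_progression[of 0 1 N] by (simp flip: of_nat_add)
  \<comment> \<open>\<open>W\<close> adds up the residues of all positions, which is the bracket in
    the claim.\<close>
  have "W = (\<Sum>x<N. x mod t)"
    using sum_residue_classes[of "{..<N}" t "\<lambda>x. x mod t"] t
    by (simp add: W_def M_def mult.commute)
  then have W: "real W = real ((N mod t) choose 2) + real (N div t) * real (t choose 2)"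
    using sum_mod_lessThan[OF t] by simp

  have S1: "(\<Sum>B\<in>Sub. real (residue_count t B c)) = real (card (M c)) * real r * real (N choose r) / real N" for c
  proof -
    have "real N * real (\<Sum>B\<in>Sub. residue_count t B c) = real (card (M c)) * real r * real (N choose r)"
      using sums[of 1 c] unfolding of_nat_mult[symmetric] by simp
    then show ?thesis using assms by (simp add: field_simps N_def)
  qed
  \<comment> \<open>Both sides of the box being at least 1 gives \<open>N \<ge> 2\<close>, which
    allows division by \<open>N choose 2\<close>.\<close>
  have N2: "N choose 2 > 0" using assms by (simp add: N_def)
  have S2: "(\<Sum>B\<in>Sub. real (residue_count t B c choose 2)) =
      real (card (M c) choose 2) * real (r choose 2) * real (N choose r) / real (N choose 2)" for c
  proof -
    have "real (N choose 2) * real (\<Sum>B\<in>Sub. residue_count t B c choose 2) =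
        real (card (M c) choose 2) * real (r choose 2) * real (N choose r)"
      using sums[of 2 c] unfolding of_nat_mult[symmetric] by simp
    then show ?thesis using N2 by (simp add: field_simps)
  qed
  have "(\<Sum>lam\<in>partitions_in_box r s. real (sum_list (t_core t lam)))
      = (\<Sum>lam\<in>partitions_in_box r s. (\<lambda>B. (\<Sum>c<t. real c * real (residue_count t B c)
          + real t * real (residue_count t B c choose 2)) - real (r choose 2)) (beads r lam))"
  proof (rule sum.cong)
    fix lam assume "lam \<in> partitions_in_box r s"
    then have "real (sum_list (t_core t lam) + (r choose 2)) =
      real (\<Sum>c<t. c * residue_count t (beads r lam) c + t * (residue_count t (beads r lam) c choose 2))"
      using sum_list_t_core[OF t, of lam r] by (simp add: partitions_in_box_def)
    then show "real (sum_list (t_core t lam)) = (\<lambda>B. (\<Sum>c<t. real c * real (residue_count t B c)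
          + real t * real (residue_count t B c choose 2)) - real (r choose 2)) (beads r lam)"
      by simp
  qed simp
  also have "\<dots> = (\<Sum>B\<in>Sub. (\<Sum>c<t. real c * real (residue_count t B c)
          + real t * real (residue_count t B c choose 2)) - real (r choose 2))"
    by (rule sum.reindex_bij_betw[OF bij])
  also have "\<dots> = (\<Sum>c<t. \<Sum>B\<in>Sub. real c * real (residue_count t B c)
          + real t * real (residue_count t B c choose 2)) - real (N choose r) * real (r choose 2)"
    unfolding sum_subtractf by (subst sum.swap) (simp add: card_Sub)
  also have "\<dots> = (\<Sum>c<t. real c * (real (card (M c)) * real r * real (N choose r) / real N)
          + real t * (real (card (M c) choose 2) * real (r choose 2) * real (N choose r) / real (N choose 2)))
          - real (N choose r) * real (r choose 2)"
    unfolding sum.distrib sum_distrib_left[symmetric] S1 S2 by simp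
  also have "\<dots> = real (N choose r) *
      (real W * real r / real N + real V * real (r choose 2) / real (N choose 2) - real (r choose 2))"
    unfolding W_def V_def
    by (simp add: sum.distrib sum_distrib_left sum_distrib_right sum_divide_distrib algebra_simps)
  \<comment> \<open>Once \<open>V\<close> is replaced, the terms free of \<open>W\<close> cancel and
    the mean is a multiple of \<open>W\<close>.\<close>
  also have "real V = real (N choose 2) - real W" using WV by simp
  also have "real W * real r / real N + (real (N choose 2) - real W) * real (r choose 2) / real (N choose 2)
      - real (r choose 2) = real W * (real r / real N - real (r choose 2) / real (N choose 2))"
    using N2 by (simp add: field_simps)
  \<comment> \<open>With \<open>N = r + s\<close> this is r/N - r(r-1)/(N(N-1)) =
    r(N-r)/(N(N-1)).\<close>
  also have "real r / real N - real (r choose 2) / real (N choose 2) =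
      real (r * s) / (real N * (real N - 1))"
  proof -
    have choose2: "real (n choose 2) = real n * (real n - 1) / 2" for n
      by (induction n) (auto simp: numeral_2_eq_2 field_simps)
    have "real N * (real N - 1) \<noteq> 0" "real N = real r + real s" using assms by (auto simp: N_def)
    then show ?thesis unfolding choose2 by (simp add: divide_simps) (simp add: algebra_simps)
  qed
  finally have "(\<Sum>lam\<in>partitions_in_box r s. real (sum_list (t_core t lam))) =
      real (N choose r) * (real W * (real (r * s) / (real N * (real N - 1))))" .
  then show ?thesis
    unfolding integral_pmf_of_set[OF nonempty fin] card
    using pos by (simp add: W N_def)
qed

end
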